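(* Let $K_1,\ldots,K_n$ be finite graded posets and $K:=K_1\times\cdots\times K_n$ with the product order. Then a map $M:K\to K$ is a special partial matching of $K$ if and only if $M=\mathrm{id}_{K_1}\times\cdots\times\mathrm{id}_{K_{i-1}}\times N\times\mathrm{id}_{K_{i+1}}\times\cdots\times\mathrm{id}_{K_n}$ for some $i\in\{1,\ldots,n\}$ and some special partial matching $N$ of $K_i$.
   Context: A finite poset is graded if it has a minimum $\hat 0$, a maximum $\hat 1$ and a rank function. Write $x\vartriangleleft y$ if $y$ covers $x$. A partial matching of a finite graded poset $K$ is a map $M_p:K\to K$ with $M_p\circ M_p=\mathrm{id}_K$, $M_p(\hat 1)\vartriangleleft\hat 1$, and for every $x$ either $M_p(x)\vartriangleleft x$, $x\vartriangleleft M_p(x)$ or $M_p(x)=x$; it is a special partial matching if $x\vartriangleleft y$ and $x\neq M_p(y)$ imply $M_p(x)\leqslant M_p(y)$. *)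

theory Defs
  imports "HOL-Library.FuncSet"
begin

text \<open>A poset is a carrier set \<open>A\<close> together with a relation \<open>r\<close> such that
  \<open>partial_order_on A r\<close>; the pair \<open>(x, y) \<in> r\<close> means \<open>x \<le> y\<close>.\<close>

definition covers_in :: "'a set \<Rightarrow> 'a rel \<Rightarrow> 'a \<Rightarrow> 'a \<Rightarrow> bool" where
  \<comment> \<open>\<open>y\<close> covers \<open>x\<close>\<close>
  "covers_in A r x y \<longleftrightarrow> x \<in> A \<and> y \<in> A \<and> x \<noteq> y \<and> (x, y) \<in> r
     \<and> (\<forall>z\<in>A. (x, z) \<in> r \<longrightarrow> (z, y) \<in> r \<longrightarrow> z = x \<or> z = y)"

definition minimum_in :: "'a set \<Rightarrow> 'a rel \<Rightarrow> 'a \<Rightarrow> bool" where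
  "minimum_in A r b \<longleftrightarrow> b \<in> A \<and> (\<forall>x\<in>A. (b, x) \<in> r)"

definition maximum_in :: "'a set \<Rightarrow> 'a rel \<Rightarrow> 'a \<Rightarrow> bool" where
  "maximum_in A r t \<longleftrightarrow> t \<in> A \<and> (\<forall>x\<in>A. (x, t) \<in> r)"

definition rank_function :: "'a set \<Rightarrow> 'a rel \<Rightarrow> ('a \<Rightarrow> nat) \<Rightarrow> bool" where
  "rank_function A r \<rho> \<longleftrightarrow> (\<forall>b. minimum_in A r b \<longrightarrow> \<rho> b = 0)
     \<and> (\<forall>x y. covers_in A r x y \<longrightarrow> \<rho> y = \<rho> x + 1)"

locale finite_graded_poset =
  fixes A :: "'a set" and r :: "'a rel"
  assumes finite_carrier: "finite A"
    and order: "partial_order_on A r"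
    and ex_minimum: "\<exists>b. minimum_in A r b"
    and ex_maximum: "\<exists>t. maximum_in A r t"
    and ex_rank: "\<exists>\<rho>. rank_function A r \<rho>"

locale partial_matching = finite_graded_poset A r for A :: "'a set" and r :: "'a rel" +
  fixes M :: "'a \<Rightarrow> 'a"
  assumes maps_to: "M \<in> A \<rightarrow> A"
    and involution: "x \<in> A \<Longrightarrow> M (M x) = x"
    and maximum_matched: "maximum_in A r t \<Longrightarrow> covers_in A r (M t) t"
    and matched: "x \<in> A \<Longrightarrow> covers_in A r (M x) x \<or> covers_in A r x (M x) \<or> M x = x"

locale special_partial_matching = partial_matching A r M
  for A :: "'a set" and r :: "'a rel" and M :: "'a \<Rightarrow> 'a" +
  assumes special: "covers_in A r x y \<Longrightarrow> x \<noteq> M y \<Longrightarrow> (M x, M y) \<in> r"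

text \<open>Elements of a product are the extensional functions on the index set, so that two of
  them are equal as soon as all their coordinates are.\<close>

definition product_carrier :: "nat \<Rightarrow> (nat \<Rightarrow> 'a set) \<Rightarrow> (nat \<Rightarrow> 'a) set" where
  "product_carrier n K = (\<Pi>\<^sub>E j\<in>{1..n}. K j)"

definition product_order ::
    "nat \<Rightarrow> (nat \<Rightarrow> 'a set) \<Rightarrow> (nat \<Rightarrow> 'a rel) \<Rightarrow> (nat \<Rightarrow> 'a) rel" where
  "product_order n K r = {(x, y). x \<in> product_carrier n K \<and> y \<in> product_carrier n K
     \<and> (\<forall>j\<in>{1..n}. (x j, y j) \<in> r j)}"

definition product_map :: "nat \<Rightarrow> (nat \<Rightarrow> 'a \<Rightarrow> 'a) \<Rightarrow> (nat \<Rightarrow> 'a) \<Rightarrow> (nat \<Rightarrow> 'a)" where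
  "product_map n f x = (\<lambda>j\<in>{1..n}. f j (x j))"

end

theory Submission
  imports Defs
begin

text \<open>Covers in the product change exactly one coordinate. Suppose \<open>M x\<close> lies below \<open>x\<close> and
  differs from it in coordinate \<open>j\<close>; moving \<open>x\<close> up in another coordinate does not affect how \<open>M\<close>
  acts, since speciality applied to the fourth corner of the square leaves no other choice. Let
  \<open>i\<close> be the coordinate in which \<open>M\<close> moves the maximum. If some \<open>x\<close> is moved in a coordinate
  \<open>j \<noteq> i\<close>, take a maximal such \<open>x\<close>: it is moved down, since otherwise \<open>M x\<close>
  would be larger, and by the square argument it is maximal in every coordinate but \<open>j\<close>. So
  the coordinate \<open>i\<close> stays maximal under \<open>M\<close> along a chain from \<open>x\<close> to the maximum, a
  contradiction. The square argument and its dual then show that \<open>M x i\<close> only depends on \<open>x i\<close>.\<close>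

section \<open>Order facts for finite posets\<close>

context finite_graded_poset
begin

lemma le_mem: "(x, y) \<in> r \<Longrightarrow> x \<in> A \<and> y \<in> A"
  using order unfolding partial_order_on_def preorder_on_def by blast

lemma le_refl: "x \<in> A \<Longrightarrow> (x, x) \<in> r"
  using order unfolding partial_order_on_def preorder_on_def refl_on_def by blast

lemma le_trans: "(x, y) \<in> r \<Longrightarrow> (y, z) \<in> r \<Longrightarrow> (x, z) \<in> r"
  using order unfolding partial_order_on_def preorder_on_def by (blast dest: transD)

lemma le_antisym: "(x, y) \<in> r \<Longrightarrow> (y, x) \<in> r \<Longrightarrow> x = y"
  using order unfolding partial_order_on_def by (blast dest: antisymD)

lemma ex_minimal_element:
  assumes "S \<subseteq> A" "S \<noteq> {}"
  obtains m where "m \<in> S" "\<forall>x\<in>S. (x, m) \<in> r \<longrightarrow> x = m"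
proof -
  let ?lt = "\<lambda>x y. (x, y) \<in> r \<and> x \<noteq> y"
  have "\<exists>m\<in>S. \<forall>x\<in>S. x \<noteq> m \<longrightarrow> \<not> ?lt x m"
    by (rule Finite_Set.bex_min_element)
      (use assms finite_carrier in \<open>auto intro: finite_subset asymp_onI transp_onI
        dest: le_antisym le_trans\<close>)
  then show thesis using that by blast
qed

lemma ex_maximal_element:
  assumes "S \<subseteq> A" "S \<noteq> {}"
  obtains m where "m \<in> S" "\<forall>x\<in>S. (m, x) \<in> r \<longrightarrow> x = m"
proof -
  let ?lt = "\<lambda>x y. (x, y) \<in> r \<and> x \<noteq> y"
  have "\<exists>m\<in>S. \<forall>x\<in>S. x \<noteq> m \<longrightarrow> \<not> ?lt m x"
    by (rule Finite_Set.bex_max_element)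
      (use assms finite_carrier in \<open>auto intro: finite_subset asymp_onI transp_onI
        dest: le_antisym le_trans\<close>)
  then show thesis using that by blast
qed

text \<open>A minimal element of the set of elements strictly above \<open>x\<close> covers
  \<open>x\<close>; here \<open>y\<close> only witnesses that this set is nonempty, so the cover
  obtained need not lie below \<open>y\<close>.\<close>

lemma ex_cover:
  assumes "(x, y) \<in> r" "x \<noteq> y"
  obtains z where "covers_in A r x z"
proof -
  let ?S = "{z. (x, z) \<in> r \<and> z \<noteq> x}"
  obtain m where m: "m \<in> ?S" "\<forall>z\<in>?S. (z, m) \<in> r \<longrightarrow> z = m"
    using ex_minimal_element[of ?S] assms le_mem by blast
  then have "covers_in A r x m"
    unfolding covers_in_def using le_mem by blast
  then show thesis using that by blast
qed

end

lemma covers_inD: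
  assumes "covers_in A r x y"
  shows "x \<in> A" "y \<in> A" "x \<noteq> y" "(x, y) \<in> r"
  using assms unfolding covers_in_def by auto

lemma covers_in_between:
  assumes "covers_in A r x y" "z \<in> A" "(x, z) \<in> r" "(z, y) \<in> r"
  shows "z = x \<or> z = y"
  using assms unfolding covers_in_def by auto

section \<open>The product order and its covers\<close>

locale graded_product =
  fixes n :: nat and K :: "nat \<Rightarrow> 'a set" and r :: "nat \<Rightarrow> 'a rel"
  assumes graded: "i \<in> {1..n} \<Longrightarrow> finite_graded_poset (K i) (r i)"
begin

abbreviation P where "P \<equiv> product_carrier n K"
abbreviation R where "R \<equiv> product_order n K r"

lemma le_iff: "(x, y) \<in> R \<longleftrightarrow> x \<in> P \<and> y \<in> P \<and> (\<forall>j\<in>{1..n}. (x j, y j) \<in> r j)"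
  unfolding product_order_def by auto

lemma P_mem: "x \<in> P \<Longrightarrow> j \<in> {1..n} \<Longrightarrow> x j \<in> K j"
  unfolding product_carrier_def by auto

lemma P_upd: "x \<in> P \<Longrightarrow> j \<in> {1..n} \<Longrightarrow> a \<in> K j \<Longrightarrow> x(j := a) \<in> P"
  unfolding product_carrier_def by (auto simp: PiE_def extensional_def)

lemma P_eqI: "x \<in> P \<Longrightarrow> y \<in> P \<Longrightarrow> (\<And>j. j \<in> {1..n} \<Longrightarrow> x j = y j) \<Longrightarrow> x = y"
  unfolding product_carrier_def by (rule PiE_ext)

lemmas K_le_refl = finite_graded_poset.le_refl[OF graded]
lemma P_le_refl: "x \<in> P \<Longrightarrow> j \<in> {1..n} \<Longrightarrow> (x j, x j) \<in> r j"
  by (rule K_le_refl[OF _ P_mem])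

lemmas K_le_trans = finite_graded_poset.le_trans[OF graded]
lemmas K_le_antisym = finite_graded_poset.le_antisym[OF graded]

text \<open>Off \<open>k\<close> the two ends agree, so by antisymmetry anything between them agrees
  with \<open>x\<close> there; in coordinate \<open>k\<close> the cover in the factor leaves only
  the two ends.\<close>

lemma covers_upd:
  assumes x: "x \<in> P" and k: "k \<in> {1..n}" and c: "covers_in (K k) (r k) (x k) a"
  shows "covers_in P R x (x(k := a))"
proof -
  have aK: "a \<in> K k" and le: "(x k, a) \<in> r k" and ne: "x k \<noteq> a"
    using covers_inD[OF c] by auto
  have y: "x(k := a) \<in> P" by (rule P_upd[OF x k aK])
  have "(x, x(k := a)) \<in> R"
    using x y le by (auto simp: le_iff P_le_refl)
  moreover have "z = x \<or> z = x(k := a)"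
    if z: "z \<in> P" "(x, z) \<in> R" "(z, x(k := a)) \<in> R" for z
  proof -
    have off: "z j = x j" if "j \<in> {1..n}" "j \<noteq> k" for j
    proof (rule K_le_antisym[OF that(1)])
      show "(z j, x j) \<in> r j" using z(3) that unfolding le_iff by (metis fun_upd_other)
      show "(x j, z j) \<in> r j" using z(2) that unfolding le_iff by blast
    qed
    have "z k = x k \<or> z k = a"
      using z k covers_in_between[OF c P_mem[OF z(1) k]] by (force simp: le_iff)
    then show ?thesis
      using off P_eqI[OF z(1) x] P_eqI[OF z(1) y] by (metis fun_upd_apply)
  qed
  moreover have "x \<noteq> x(k := a)" using ne by (metis fun_upd_same)
  ultimately show ?thesis unfolding covers_in_def using x y by blast
qed

text \<open>Pick a coordinate \<open>k\<close> where \<open>x\<close> and \<open>y\<close> differ.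
  Replacing \<open>x k\<close> by any \<open>a\<close> between \<open>x k\<close> and
  \<open>y k\<close> gives an element between \<open>x\<close> and \<open>y\<close>, hence one of
  these two. The choice \<open>a = y k\<close> shows that nothing else changes, and arbitrary
  \<open>a\<close> gives the cover in the factor.\<close>

lemma covers_prodE:
  assumes c: "covers_in P R x y"
  obtains k where "k \<in> {1..n}" "covers_in (K k) (r k) (x k) (y k)" "y = x(k := y k)"
proof -
  have x: "x \<in> P" and y: "y \<in> P" and ne: "x \<noteq> y" and le: "(x, y) \<in> R"
    using covers_inD[OF c] by auto
  obtain k where k: "k \<in> {1..n}" "x k \<noteq> y k" using P_eqI[OF x y] ne by blast
  have between: "a = x k \<or> a = y k \<and> y = x(k := a)"
    if a: "a \<in> K k" "(x k, a) \<in> r k" "(a, y k) \<in> r k" for a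
  proof -
    have z: "x(k := a) \<in> P" by (rule P_upd[OF x k(1) a(1)])
    have "(x, x(k := a)) \<in> R" "(x(k := a), y) \<in> R"
      using x y z le a by (auto simp: le_iff P_le_refl)
    then have "x(k := a) = x \<or> x(k := a) = y" using covers_in_between[OF c z] by blast
    then show ?thesis by (metis fun_upd_same)
  qed
  have yk: "y k \<in> K k" and xy: "(x k, y k) \<in> r k" using k le P_mem[OF y] by (auto simp: le_iff)
  have "covers_in (K k) (r k) (x k) (y k)"
    unfolding covers_in_def using P_mem[OF x k(1)] yk xy k(2) between by blast
  moreover have "y = x(k := y k)" using between[OF yk xy K_le_refl[OF k(1) yk]] k(2) by metis
  ultimately show thesis using that k(1) by blast
qed

section \<open>Extrema and rank function of the product\<close>

lemma ex_prod_maximum: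
  obtains t where "t \<in> P" "\<And>j. j \<in> {1..n} \<Longrightarrow> maximum_in (K j) (r j) (t j)"
proof -
  have "\<exists>t. maximum_in (K j) (r j) t" if "j \<in> {1..n}" for j
    using finite_graded_poset.ex_maximum[OF graded[OF that]] .
  then obtain f where f: "\<And>j. j \<in> {1..n} \<Longrightarrow> maximum_in (K j) (r j) (f j)" by metis
  show thesis
    by (rule that[of "restrict f {1..n}"])
      (use f in \<open>auto simp: product_carrier_def maximum_in_def\<close>)
qed

lemma ex_prod_minimum:
  obtains t where "t \<in> P" "\<And>j. j \<in> {1..n} \<Longrightarrow> minimum_in (K j) (r j) (t j)"
proof -
  have "\<exists>t. minimum_in (K j) (r j) t" if "j \<in> {1..n}" for j
    using finite_graded_poset.ex_minimum[OF graded[OF that]] .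
  then obtain f where f: "\<And>j. j \<in> {1..n} \<Longrightarrow> minimum_in (K j) (r j) (f j)" by metis
  show thesis
    by (rule that[of "restrict f {1..n}"])
      (use f in \<open>auto simp: product_carrier_def minimum_in_def\<close>)
qed

text \<open>The axiom \<open>maximum_matched\<close> speaks about any element satisfying
  \<open>maximum_in\<close>; this identifies that element with the tuple of the maxima of the
  factors.\<close>

lemma maximum_in_P_iff:
  assumes t: "t \<in> P" "\<And>j. j \<in> {1..n} \<Longrightarrow> maximum_in (K j) (r j) (t j)"
  shows "maximum_in P R s \<longleftrightarrow> s = t"
proof
  have tm: "(x, t) \<in> R" if "x \<in> P" for x
    using t that P_mem by (auto simp: le_iff maximum_in_def)
  show "maximum_in P R s" if "s = t" using that tm t(1) by (auto simp: maximum_in_def)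
  show "s = t" if s: "maximum_in P R s"
  proof (rule P_eqI)
    fix j assume j: "j \<in> {1..n}"
    have "(t, s) \<in> R" "(s, t) \<in> R" using s tm t(1) by (auto simp: maximum_in_def)
    then show "s j = t j" using K_le_antisym[OF j] j by (auto simp: le_iff)
  qed (use s t in \<open>auto simp: maximum_in_def\<close>)
qed

text \<open>Varying only coordinate \<open>j\<close> of \<open>t\<close> compares \<open>t j\<close>
  with all of \<open>K j\<close>. This makes every summand of the rank vanish at the minimum of the
  product.\<close>

lemma minimum_in_PD:
  assumes t: "minimum_in P R t" and j: "j \<in> {1..n}"
  shows "minimum_in (K j) (r j) (t j)"
  unfolding minimum_in_def
proof
  have tP: "t \<in> P" using t by (auto simp: minimum_in_def)
  then show "t j \<in> K j" using P_mem j by blast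
  show "\<forall>a\<in>K j. (t j, a) \<in> r j"
  proof
    fix a assume "a \<in> K j"
    then have "(t, t(j := a)) \<in> R" using t P_upd[OF tP j] by (auto simp: minimum_in_def)
    then show "(t j, a) \<in> r j" using j by (force simp: le_iff)
  qed
qed

lemma finite_graded_poset_product: "finite_graded_poset P R"
proof
  show "finite P" unfolding product_carrier_def
    by (rule finite_PiE) (use finite_graded_poset.finite_carrier[OF graded] in auto)
  show "partial_order_on P R"
    unfolding partial_order_on_def preorder_on_def
  proof (intro conjI)
    show "R \<subseteq> P \<times> P" by (auto simp: le_iff)
    show "refl_on P R" by (auto simp: refl_on_def le_iff P_le_refl)
    show "trans R" by (rule transI) (auto simp: le_iff intro: K_le_trans)
    show "antisym R"
    proof (rule antisymI)
      fix x y assume "(x, y) \<in> R" "(y, x) \<in> R"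
      then show "x = y" using P_eqI[of x y] K_le_antisym unfolding le_iff by blast
    qed
  qed
  obtain t where t: "t \<in> P" "\<And>j. j \<in> {1..n} \<Longrightarrow> maximum_in (K j) (r j) (t j)"
    using ex_prod_maximum by metis
  then show "\<exists>t. maximum_in P R t" using maximum_in_P_iff by blast
  obtain b where b: "b \<in> P" "\<And>j. j \<in> {1..n} \<Longrightarrow> minimum_in (K j) (r j) (b j)"
    using ex_prod_minimum by metis
  then show "\<exists>b. minimum_in P R b"
    using P_mem by (auto simp: minimum_in_def le_iff intro!: exI[of _ b])
  have "\<exists>\<rho>. rank_function (K j) (r j) \<rho>" if "j \<in> {1..n}" for j
    using finite_graded_poset.ex_rank[OF graded[OF that]] .
  then obtain \<rho> where \<rho>: "\<And>j. j \<in> {1..n} \<Longrightarrow> rank_function (K j) (r j) (\<rho> j)" by metis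
  \<comment> \<open>Ranks add up: a cover of the product changes exactly one summand, and by
    one.\<close>
  have "rank_function P R (\<lambda>x. \<Sum>j\<in>{1..n}. \<rho> j (x j))"
    unfolding rank_function_def
  proof (intro conjI allI impI)
    fix b assume "minimum_in P R b"
    then show "(\<Sum>j\<in>{1..n}. \<rho> j (b j)) = 0"
      using minimum_in_PD \<rho> by (auto simp: rank_function_def)
  next
    fix x y assume "covers_in P R x y"
    then obtain k where k: "k \<in> {1..n}" "covers_in (K k) (r k) (x k) (y k)" "y = x(k := y k)"
      by (rule covers_prodE)
    have "(\<Sum>j\<in>{1..n} - {k}. \<rho> j (y j)) = (\<Sum>j\<in>{1..n} - {k}. \<rho> j (x j))"
      by (rule sum.cong[OF refl], subst k(3)) auto
    moreover have "\<rho> k (y k) = \<rho> k (x k) + 1"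
      using \<rho>[OF k(1)] k(2) by (auto simp: rank_function_def)
    ultimately show "(\<Sum>j\<in>{1..n}. \<rho> j (y j)) = (\<Sum>j\<in>{1..n}. \<rho> j (x j)) + 1"
      using k(1) by (simp add: sum.remove)
  qed
  then show "\<exists>\<rho>. rank_function P R \<rho>" by blast
qed

section \<open>Extending a matching of one factor by identities\<close>

lemma special_partial_matching_product_map:
  assumes i: "i \<in> {1..n}" and N: "special_partial_matching (K i) (r i) N"
    and M: "\<And>x. x \<in> P \<Longrightarrow> M x = product_map n (\<lambda>j. if j = i then N else id) x"
  shows "special_partial_matching P R M"
proof -
  interpret N: special_partial_matching "K i" "r i" N by (rule N)
  interpret P: finite_graded_poset P R by (rule finite_graded_poset_product)
  have M_upd: "M x = x(i := N (x i))" if x: "x \<in> P" for x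
    unfolding M[OF x] using x i
    by (auto simp: product_map_def product_carrier_def PiE_def extensional_def restrict_def)
  have NK: "N a \<in> K i" if "a \<in> K i" for a using N.maps_to that by blast
  have M_closed: "M x \<in> P" if x: "x \<in> P" for x
    unfolding M_upd[OF x] by (rule P_upd[OF x i NK[OF P_mem[OF x i]]])
  \<comment> \<open>\<open>covers_upd\<close> raises a coordinate, so it is applied at the lower end
    \<open>x(i := a)\<close>; setting coordinate \<open>i\<close> back to \<open>x i\<close>
    recovers \<open>x\<close>.\<close>
  have down: "covers_in P R (x(i := a)) x"
    if "x \<in> P" "covers_in (K i) (r i) a (x i)" for x a
    using covers_upd[of "x(i := a)" i "x i"] P_upd[OF that(1) i] i that covers_inD(1)[OF that(2)]
    by simp
  show ?thesis
  proof unfold_locales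
    show "M \<in> P \<rightarrow> P" using M_closed by blast
    show "M (M x) = x" if x: "x \<in> P" for x
      unfolding M_upd[OF M_closed[OF x]] using M_upd[OF x] N.involution[OF P_mem[OF x i]] by simp
    show "covers_in P R (M x) x \<or> covers_in P R x (M x) \<or> M x = x" if x: "x \<in> P" for x
      unfolding M_upd[OF x] using N.matched[OF P_mem[OF x i]] down[OF x] covers_upd[OF x i] by auto
  next
    fix s assume s: "maximum_in P R s"
    obtain t where t: "t \<in> P" "\<And>j. j \<in> {1..n} \<Longrightarrow> maximum_in (K j) (r j) (t j)"
      using ex_prod_maximum by metis
    then have "s = t" using s maximum_in_P_iff by blast
    then show "covers_in P R (M s) s"
      using M_upd[OF t(1)] down[OF t(1)] N.maximum_matched[OF t(2)[OF i]] by simp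
  next
    fix x y assume c: "covers_in P R x y" and ne: "x \<noteq> M y"
    have x: "x \<in> P" and y: "y \<in> P" and le: "(x, y) \<in> R" using covers_inD[OF c] by auto
    obtain k where k: "k \<in> {1..n}" "covers_in (K k) (r k) (x k) (y k)" "y = x(k := y k)"
      using c by (rule covers_prodE)
    \<comment> \<open>Only coordinate \<open>i\<close> needs an argument, as the others inherit
      \<open>x <= y\<close>. If the cover is in coordinate \<open>i\<close>, then \<open>x\<close>
      and \<open>y\<close> agree elsewhere, so \<open>x \<noteq> M y\<close> must already show in
      coordinate \<open>i\<close> and \<open>N\<close> is special there. Otherwise
      \<open>x i = y i\<close>.\<close>
    have "(N (x i), N (y i)) \<in> r i"
    proof (cases "k = i")
      case True
      have "x \<noteq> y(i := N (y i))" using ne M_upd[OF y] by simp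
      then have "x i \<noteq> N (y i)" using k(3) True by (metis fun_upd_triv fun_upd_upd)
      then show ?thesis using N.special k(2) True by blast
    next
      case False
      then have "y i = x i" by (subst k(3)) simp
      then show ?thesis using K_le_refl[OF i] NK P_mem[OF x i] by simp
    qed
    then show "(M x, M y) \<in> R"
      using M_closed[OF x] M_closed[OF y] le M_upd[OF x] M_upd[OF y] by (auto simp: le_iff)
  qed
qed

end

section \<open>Special partial matchings on squares of covers\<close>

locale product_matching = graded_product n K r +
  special_partial_matching "product_carrier n K" "product_order n K r" M
  for n K r M
begin

lemma M_closed: "x \<in> P \<Longrightarrow> M x \<in> P"
  using maps_to by blast

text \<open>Since a cover of the product is a cover in one factor, the alternatives of
  \<open>matched\<close> become statements about a single coordinate; later arguments track one
  coordinate at a time.\<close>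

lemma M_cases:
  assumes x: "x \<in> P"
  obtains (fixed) "M x = x"
  | (down) l a where "l \<in> {1..n}" "covers_in (K l) (r l) a (x l)" "M x = x(l := a)"
  | (up) l a where "l \<in> {1..n}" "covers_in (K l) (r l) (x l) a" "M x = x(l := a)"
proof -
  consider "covers_in P R (M x) x" | "covers_in P R x (M x)" | "M x = x"
    using matched[OF x] by blast
  then show thesis
  proof cases
    case 1
    then obtain k where k: "k \<in> {1..n}" "covers_in (K k) (r k) (M x k) (x k)" "x = (M x)(k := x k)"
      by (rule covers_prodE)
    have "M x = x(k := M x k)" by (subst k(3)) simp
    then show thesis using down k by blast
  next
    case 2
    then show thesis using up by (metis covers_prodE)
  qed (rule fixed)
qed

text \<open>On the lower edge from \<open>?w\<close> to the fourth corner \<open>?w'\<close>,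
  speciality gives \<open>x <= M ?w'\<close>, because \<open>M ?w = x\<close>. Hence
  \<open>M\<close> must lift coordinate \<open>j\<close> of \<open>?w'\<close> from \<open>b\<close>
  to at least \<open>x j\<close>. A matched move is a cover in one coordinate, so it reaches exactly
  \<open>x j\<close> and leaves the rest alone; the involution turns this into the claim.\<close>

lemma square_up:
  assumes x: "x \<in> P" and j: "j \<in> {1..n}" and k: "k \<in> {1..n}" and jk: "j \<noteq> k"
    and b: "covers_in (K j) (r j) b (x j)" and Mx: "M x = x(j := b)"
    and c: "covers_in (K k) (r k) (x k) c"
  shows "M (x(k := c)) = x(k := c, j := b)"
proof -
  let ?w = "x(j := b)" and ?w' = "x(k := c, j := b)"
  have w: "?w \<in> P" using P_upd[OF x j covers_inD(1)[OF b]] .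
  have w': "?w' \<in> P" using P_upd[OF P_upd[OF x k covers_inD(2)[OF c]] j covers_inD(1)[OF b]] .
  have Mw: "M ?w = x" using involution[OF x] Mx by simp
  have cov: "covers_in P R ?w ?w'"
    using covers_upd[OF w k, of c] c jk by (simp add: fun_upd_twist)
  \<comment> \<open>The exceptional case of \<open>special\<close> would force
    \<open>?w' = M ?w = x\<close>, but these differ in coordinate \<open>k\<close>.\<close>
  have "?w \<noteq> M ?w'"
  proof
    assume "?w = M ?w'"
    then have "x = ?w'" using Mw involution[OF w'] by simp
    then show False using covers_inD(3)[OF c] jk by (metis fun_upd_apply)
  qed
  then have le: "(x, M ?w') \<in> R" using special[OF cov] Mw by simp
  then have lej: "(x j, M ?w' j) \<in> r j" using j by (auto simp: le_iff)
  \<comment> \<open>Excludes every case in which coordinate \<open>j\<close> of \<open>?w'\<close>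
    is kept at \<open>b\<close> or lowered.\<close>
  have not_le: "\<not> (M ?w' j, b) \<in> r j"
    using lej K_le_trans[OF j lej] K_le_antisym[OF j] covers_inD[OF b] by blast
  from w' have "M ?w' = x(k := c)"
  proof (cases rule: M_cases)
    case fixed
    then have "M ?w' j = b" by simp
    then show ?thesis using not_le K_le_refl[OF j covers_inD(1)[OF b]] by simp
  next
    case (down l a)
    then have "M ?w' j = (if l = j then a else b)" by simp
    then show ?thesis
      using not_le K_le_refl[OF j covers_inD(1)[OF b]] covers_inD(4)[OF down(2)]
      by (auto split: if_splits)
  next
    case (up l a)
    then have v: "M ?w' j = (if l = j then a else b)" by simp
    then have l: "l = j" using not_le K_le_refl[OF j covers_inD(1)[OF b]] by (auto split: if_splits)
    then have "covers_in (K j) (r j) b a" "(x j, a) \<in> r j" using up lej v by auto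
    then have "x j = a"
      using covers_in_between[of "K j" "r j" b a "x j"] P_mem[OF x j] covers_inD[OF b] by blast
    then show ?thesis using up(3) l jk by auto
  qed
  then show ?thesis using involution[OF w'] by simp
qed

text \<open>Order dual of \<open>square_up\<close>: now \<open>?w\<close> covers \<open>?w'\<close>,
  and speciality gives \<open>M ?w' <= x\<close>, so coordinate \<open>j\<close> has to drop from
  \<open>b\<close> to \<open>x j\<close>.\<close>

lemma square_down:
  assumes x: "x \<in> P" and j: "j \<in> {1..n}" and k: "k \<in> {1..n}" and jk: "j \<noteq> k"
    and b: "covers_in (K j) (r j) (x j) b" and Mx: "M x = x(j := b)"
    and c: "covers_in (K k) (r k) c (x k)"
  shows "M (x(k := c)) = x(k := c, j := b)"
proof -
  let ?w = "x(j := b)" and ?w' = "x(k := c, j := b)"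
  have w: "?w \<in> P" using P_upd[OF x j covers_inD(2)[OF b]] .
  have w': "?w' \<in> P" using P_upd[OF P_upd[OF x k covers_inD(1)[OF c]] j covers_inD(2)[OF b]] .
  have Mw: "M ?w = x" using involution[OF x] Mx by simp
  have "?w'(k := x k) = ?w" using jk by auto
  then have cov: "covers_in P R ?w' ?w"
    using covers_upd[OF w' k, of "x k"] c jk by simp
  have "?w' \<noteq> M ?w"
  proof
    assume "?w' = M ?w"
    then have "x = ?w'" using Mw by simp
    then show False using covers_inD(3)[OF c] jk by (metis fun_upd_apply)
  qed
  then have le: "(M ?w', x) \<in> R" using special[OF cov] Mw by simp
  then have lej: "(M ?w' j, x j) \<in> r j" using j by (auto simp: le_iff)
  have not_le: "\<not> (b, M ?w' j) \<in> r j"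
    using lej K_le_trans[OF j _ lej] K_le_antisym[OF j] covers_inD[OF b] by blast
  from w' have "M ?w' = x(k := c)"
  proof (cases rule: M_cases)
    case fixed
    then have "M ?w' j = b" by simp
    then show ?thesis using not_le K_le_refl[OF j covers_inD(2)[OF b]] by simp
  next
    case (up l a)
    then have "M ?w' j = (if l = j then a else b)" by simp
    then show ?thesis
      using not_le K_le_refl[OF j covers_inD(2)[OF b]] covers_inD(4)[OF up(2)]
      by (auto split: if_splits)
  next
    case (down l a)
    then have v: "M ?w' j = (if l = j then a else b)" by simp
    then have l: "l = j" using not_le K_le_refl[OF j covers_inD(2)[OF b]] by (auto split: if_splits)
    then have "covers_in (K j) (r j) a b" "(a, x j) \<in> r j" using down lej v by auto
    then have "x j = a"
      using covers_in_between[of "K j" "r j" a b "x j"] P_mem[OF x j] covers_inD[OF b] by blast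
    then show ?thesis using down(3) l jk by auto
  qed
  then show ?thesis using involution[OF w'] by simp
qed

section \<open>All moves happen in the coordinate moved at the maximum\<close>

lemma M_off_coordinate:
  assumes t: "t \<in> P" "\<And>j. j \<in> {1..n} \<Longrightarrow> maximum_in (K j) (r j) (t j)"
    and i: "i \<in> {1..n}" and Mt: "M t i \<noteq> t i"
    and x: "x \<in> P" and j: "j \<in> {1..n}" and ji: "j \<noteq> i"
  shows "M x j = x j"
proof (rule ccontr)
  assume neq: "M x j \<noteq> x j"
  have tmax: "(y, t) \<in> R" if "y \<in> P" for y
    using t that P_mem by (auto simp: le_iff maximum_in_def)
  let ?B = "{y \<in> P. \<exists>l\<in>{1..n}. l \<noteq> i \<and> M y l \<noteq> y l}"
  have "?B \<subseteq> P" "?B \<noteq> {}" using x j ji neq by blast+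
  then obtain m where "m \<in> ?B" and mmax: "\<forall>y\<in>?B. (m, y) \<in> R \<longrightarrow> y = m"
    by (rule ex_maximal_element)
  then obtain l where m: "m \<in> P" and l: "l \<in> {1..n}" "l \<noteq> i" "M m l \<noteq> m l" by blast
  obtain b where b: "covers_in (K l) (r l) b (m l)" and Mm: "M m = m(l := b)"
    using m
  proof (cases rule: M_cases)
    case (up k a)
    \<comment> \<open>The involution puts \<open>M m\<close> into \<open>?B\<close> together with
      \<open>m\<close>, so an upward move contradicts maximality.\<close>
    have "M m \<in> ?B" using M_closed[OF m] involution[OF m] l by (auto intro!: bexI[of _ l])
    moreover have "(m, M m) \<in> R" using covers_inD(4)[OF covers_upd[OF m up(1,2)]] up(3) by simp
    ultimately have "M m = m" using mmax by blast
    then show ?thesis using l(3) by simp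
  next
    case (down k a)
    then have "k = l" using l(3) by (auto split: if_splits simp: fun_upd_def)
    then show ?thesis using down that by blast
  qed (use l in auto)
  \<comment> \<open>Otherwise \<open>square_up\<close> along a cover in coordinate \<open>k\<close>
    yields a larger element that is still moved in coordinate \<open>l\<close>, contradicting
    maximality. This applies in particular to \<open>k = i\<close>.\<close>
  have mk: "m k = t k" if k: "k \<in> {1..n}" "k \<noteq> l" for k
  proof (rule ccontr)
    assume "m k \<noteq> t k"
    moreover have "(m k, t k) \<in> r k" using tmax[OF m] k by (auto simp: le_iff)
    ultimately obtain c where c: "covers_in (K k) (r k) (m k) c"
      using finite_graded_poset.ex_cover[OF graded[OF k(1)]] by blast
    have "M (m(k := c)) = m(k := c, l := b)"
      using square_up[OF m l(1) k(1) _ b Mm c] k(2) by blast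
    then have "m(k := c) \<in> ?B"
      using P_upd[OF m k(1) covers_inD(2)[OF c]] l k(2) covers_inD(3)[OF b]
      by (auto intro!: bexI[of _ l])
    moreover have "(m, m(k := c)) \<in> R" using covers_inD(4)[OF covers_upd[OF m k(1) c]] .
    ultimately have "m(k := c) = m" using mmax by blast
    then show False using covers_inD(3)[OF c] by (metis fun_upd_same)
  qed
  have top: "a = t i" if "(t i, a) \<in> r i" for a
  proof -
    have "a \<in> K i" using finite_graded_poset.le_mem[OF graded[OF i] that] by blast
    then show ?thesis using t(2)[OF i] that K_le_antisym[OF i] by (auto simp: maximum_in_def)
  qed
  \<comment> \<open>It contains \<open>m\<close>, which has \<open>m i = t i\<close> and is moved
    only in coordinate \<open>l\<close>, but not \<open>t\<close>. Yet it is closed under passing to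
    covers, so a maximal \<open>z\<close> in it gives the contradiction.\<close>
  let ?S = "{z \<in> P. z i = t i \<and> M z i = t i}"
  have "m \<in> ?S" using m mk[OF i] Mm l(2) by auto
  then have "?S \<subseteq> P" "?S \<noteq> {}" by blast+
  then obtain z where "z \<in> ?S" and zmax: "\<forall>y\<in>?S. (z, y) \<in> R \<longrightarrow> y = z"
    by (rule ex_maximal_element)
  then have z: "z \<in> P" "z i = t i" "M z i = t i" by auto
  have "z \<noteq> t" using z(3) Mt by auto
  then obtain y where y: "covers_in P R z y" using ex_cover[OF tmax[OF z(1)]] by blast
  have yP: "y \<in> P" and zy: "(z, y) \<in> R" "z \<noteq> y" using covers_inD[OF y] by auto
  have "(z i, y i) \<in> r i" using zy(1) i by (auto simp: le_iff)
  then have "y i = t i" using z(2) top by simp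
  moreover have "M y i = t i"
  \<comment> \<open>Speciality would give \<open>M z <= M y\<close> and so keep coordinate
    \<open>i\<close> at the top; in its exceptional case \<open>M y\<close> is \<open>z\<close>,
    whose coordinate \<open>i\<close> is the top already.\<close>
  proof (cases "z = M y")
    case True
    then show ?thesis using z(2) by simp
  next
    case False
    then have "(M z, M y) \<in> R" using special[OF y] by blast
    then have "(M z i, M y i) \<in> r i" using i by (auto simp: le_iff)
    then show ?thesis using z(3) top by simp
  qed
  ultimately show False using zmax yP zy by blast
qed

text \<open>If \<open>M\<close> moves \<open>x\<close> down, \<open>square_up\<close> transports the
  move to \<open>?y\<close>; if \<open>M\<close> moves \<open>?y\<close> up,
  \<open>square_down\<close> transports it back to \<open>x\<close>. Otherwise
  \<open>M ?y i <= x i <= M x i\<close>, while speciality gives \<open>M x i <= M ?y i\<close>, so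
  all three agree.\<close>

lemma M_coordinate_cong_cover:
  assumes i: "i \<in> {1..n}" and off: "\<And>x j. x \<in> P \<Longrightarrow> j \<in> {1..n} \<Longrightarrow> j \<noteq> i \<Longrightarrow> M x j = x j"
    and x: "x \<in> P" and k: "k \<in> {1..n}" "k \<noteq> i" and c: "covers_in (K k) (r k) (x k) c"
  shows "M (x(k := c)) i = M x i"
proof -
  let ?y = "x(k := c)"
  have y: "?y \<in> P" using P_upd[OF x k(1) covers_inD(2)[OF c]] .
  \<comment> \<open>\<open>M\<close> preserves coordinate \<open>k\<close>, where \<open>x\<close>
    and \<open>?y\<close> differ, so the exceptional case of \<open>special\<close> cannot
    occur.\<close>
  have ne: "x \<noteq> M ?y" using off[OF y k] covers_inD(3)[OF c] by (metis fun_upd_same)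
  then have "(M x, M ?y) \<in> R" using special[OF covers_upd[OF x k(1) c]] by blast
  then have le: "(M x i, M ?y i) \<in> r i" using i by (auto simp: le_iff)
  have coord: "l = i" if "z \<in> P" "l \<in> {1..n}" "M z = z(l := a)" "a \<noteq> z l" for z l a
    using off[OF that(1,2)] that(3,4) by auto
  have case_down: ?thesis if a: "covers_in (K i) (r i) a (x i)" "M x = x(i := a)" for a
    using square_up[OF x i k(1) _ a c] a(2) k(2) by simp
  have case_up: ?thesis if a: "covers_in (K i) (r i) (x i) a" "M ?y = ?y(i := a)" for a
  proof -
    have "M (?y(k := x k)) = ?y(k := x k, i := a)"
      by (rule square_down[OF y i k(1) _ _ a(2)]) (use a(1) c k(2) in auto)
    then show ?thesis using a(2) by simp
  qed
  show ?thesis using x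
  proof (cases rule: M_cases)
    case (down l a)
    then show ?thesis using coord[OF x down(1,3)] covers_inD(3)[OF down(2)] case_down by auto
  next
    case (up l a)
    have l: "l = i" using coord[OF x up(1,3)] covers_inD(3)[OF up(2)] by auto
    show ?thesis using y
    proof (cases rule: M_cases)
      case fixed
      then have "M ?y i = x i" using k(2) by simp
      then show ?thesis using le up l covers_inD[OF up(2)] K_le_antisym[OF i] by auto
    next
      case (down l' a')
      have l': "l' = i" using coord[OF y down(1,3)] covers_inD(3)[OF down(2)] by auto
      have "(a, a') \<in> r i" "(a', x i) \<in> r i" "(x i, a) \<in> r i"
        using le up down l l' k(2) covers_inD(4)[OF down(2)] covers_inD(4)[OF up(2)] by auto
      then have "a = x i" using K_le_trans[OF i] K_le_antisym[OF i] by blast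
      then show ?thesis using l covers_inD(3)[OF up(2)] by simp
    next
      case (up l' a')
      have l': "l' = i" using coord[OF y up(1,3)] covers_inD(3)[OF up(2)] by auto
      then show ?thesis using up case_up k(2) by auto
    qed
  next
    case fixed
    show ?thesis using y
    proof (cases rule: M_cases)
      case fixed
      then show ?thesis using \<open>M x = x\<close> k(2) by simp
    next
      case (down l' a')
      have l': "l' = i" using coord[OF y down(1,3)] covers_inD(3)[OF down(2)] by auto
      have "(x i, a') \<in> r i" "(a', x i) \<in> r i"
        using le fixed down l' k(2) covers_inD(4)[OF down(2)] by auto
      then have "a' = x i" using K_le_antisym[OF i] by blast
      then show ?thesis using l' k(2) covers_inD(3)[OF down(2)] by simp
    next
      case (up l' a')
      have l': "l' = i" using coord[OF y up(1,3)] covers_inD(3)[OF up(2)] by auto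
      then show ?thesis using up case_up k(2) by auto
    qed
  qed
qed

text \<open>Raising the coordinates other than \<open>i\<close> along covers changes neither
  \<open>x i\<close> nor \<open>M x i\<close>. A maximal element reached in this way has all those
  coordinates at their maxima, so it is \<open>t(i := x i)\<close>.\<close>

lemma M_coordinate_eq_slice:
  assumes t: "t \<in> P" "\<And>j. j \<in> {1..n} \<Longrightarrow> maximum_in (K j) (r j) (t j)"
    and i: "i \<in> {1..n}" and off: "\<And>x j. x \<in> P \<Longrightarrow> j \<in> {1..n} \<Longrightarrow> j \<noteq> i \<Longrightarrow> M x j = x j"
    and x: "x \<in> P"
  shows "M x i = M (t(i := x i)) i"
proof -
  let ?S = "{z \<in> P. z i = x i \<and> M z i = M x i}"
  have "?S \<subseteq> P" "?S \<noteq> {}" using x by blast+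
  then obtain z where "z \<in> ?S" and zmax: "\<forall>y\<in>?S. (z, y) \<in> R \<longrightarrow> y = z"
    by (rule ex_maximal_element)
  then have z: "z \<in> P" "z i = x i" "M z i = M x i" by auto
  have "z k = t k" if k: "k \<in> {1..n}" "k \<noteq> i" for k
  proof (rule ccontr)
    assume "z k \<noteq> t k"
    moreover have "(z k, t k) \<in> r k"
      using t(2)[OF k(1)] P_mem[OF z(1) k(1)] by (auto simp: maximum_in_def)
    ultimately obtain c where c: "covers_in (K k) (r k) (z k) c"
      using finite_graded_poset.ex_cover[OF graded[OF k(1)]] by blast
    have "z(k := c) \<in> ?S"
      using P_upd[OF z(1) k(1) covers_inD(2)[OF c]] z k
        M_coordinate_cong_cover[OF i off z(1) k c] by auto
    moreover have "(z, z(k := c)) \<in> R" using covers_inD(4)[OF covers_upd[OF z(1) k(1) c]] .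
    ultimately have "z(k := c) = z" using zmax by blast
    then show False using covers_inD(3)[OF c] by (metis fun_upd_same)
  qed
  then have "z = t(i := x i)"
    using P_eqI[OF z(1) P_upd[OF t(1) i P_mem[OF x i]]] z(2) by auto
  then show ?thesis using z(3) by simp
qed

section \<open>The matching induced on one factor\<close>

lemma ex_coordinate_matching:
  "\<exists>i\<in>{1..n}. \<exists>N. special_partial_matching (K i) (r i) N \<and>
    (\<forall>x\<in>P. M x = product_map n (\<lambda>j. if j = i then N else id) x)"
proof -
  obtain t where t: "t \<in> P" "\<And>j. j \<in> {1..n} \<Longrightarrow> maximum_in (K j) (r j) (t j)"
    using ex_prod_maximum by metis
  then have "covers_in P R (M t) t" using maximum_in_P_iff maximum_matched by blast
  \<comment> \<open>The only place where \<open>i\<close> is chosen. For \<open>n = 0\<close> the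
    product is a single point without covers, so the assumed matching is contradictory, as it should
    be.\<close>
  then obtain i where i: "i \<in> {1..n}" and ci: "covers_in (K i) (r i) (M t i) (t i)"
    by (rule covers_prodE)
  have off: "M x j = x j" if "x \<in> P" "j \<in> {1..n}" "j \<noteq> i" for x j
    using M_off_coordinate[OF t i covers_inD(3)[OF ci] that] .
  let ?e = "\<lambda>a. t(i := a)"
  \<comment> \<open>\<open>N\<close> is \<open>M\<close> read on the line through the maximum in
    direction \<open>i\<close>. By \<open>M_coordinate_eq_slice\<close> every parallel line gives
    the same map, and on this line the condition at the maximum of \<open>K i\<close> comes directly
    from that at \<open>t\<close>.\<close>
  define N where "N a = M (?e a) i" for a
  have e: "?e a \<in> P" if "a \<in> K i" for a using P_upd[OF t(1) i that] .
  have M_upd: "M x = x(i := N (x i))" if x: "x \<in> P" for x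
  proof (rule P_eqI[OF M_closed[OF x]])
    have MK: "M x i \<in> K i" using P_mem[OF M_closed[OF x] i] .
    have v: "M x i = N (x i)" using M_coordinate_eq_slice[OF t i off x] N_def by simp
    then show "x(i := N (x i)) \<in> P" using P_upd[OF x i] MK by simp
    show "M x j = (x(i := N (x i))) j" if "j \<in> {1..n}" for j using v off[OF x that] by simp
  qed
  have Me: "M (?e a) = ?e (N a)" if "a \<in> K i" for a using M_upd[OF e[OF that]] by simp
  have NK: "N a \<in> K i" if "a \<in> K i" for a
    unfolding N_def by (rule P_mem[OF M_closed[OF e[OF that]] i])
  \<comment> \<open>Two points of the line agree off \<open>i\<close>, so the coordinate supplied by
    \<open>covers_prodE\<close> must be \<open>i\<close>.\<close>
  have cov: "covers_in (K i) (r i) a b" if "covers_in P R (?e a) (?e b)" for a b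
    using that
  proof (rule covers_prodE)
    fix k assume "covers_in (K k) (r k) (?e a k) (?e b k)"
    then show ?thesis using covers_inD(3)[of "K k"] by (cases "k = i") auto
  qed
  have e_inj: "a = b" if "?e a = ?e b" for a b using that by (metis fun_upd_same)
  interpret Ki: finite_graded_poset "K i" "r i" by (rule graded[OF i])
  have "special_partial_matching (K i) (r i) N"
  proof unfold_locales
    show "N \<in> K i \<rightarrow> K i" using NK by blast
    show "N (N a) = a" if a: "a \<in> K i" for a
      using involution[OF e[OF a]] Me[OF a] Me[OF NK[OF a]] e_inj by metis
    show "covers_in (K i) (r i) (N a) a \<or> covers_in (K i) (r i) a (N a) \<or> N a = a"
      if a: "a \<in> K i" for a
      using matched[OF e[OF a]] unfolding Me[OF a] using cov e_inj by blast
  next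
    fix s assume "maximum_in (K i) (r i) s"
    then have "s = t i" using t(2)[OF i] Ki.le_antisym by (auto simp: maximum_in_def)
    moreover have "M t i = N (t i)" unfolding N_def by simp
    ultimately show "covers_in (K i) (r i) (N s) s" using ci by simp
  next
    fix a b assume c: "covers_in (K i) (r i) a b" and ne: "a \<noteq> N b"
    have a: "a \<in> K i" and b: "b \<in> K i" using covers_inD[OF c] by auto
    have "covers_in P R (?e a) (?e b)" using covers_upd[OF e[OF a] i, of b] c by simp
    moreover have "?e a \<noteq> M (?e b)" using ne Me[OF b] e_inj by metis
    ultimately have "(?e (N a), ?e (N b)) \<in> R" using special Me[OF a] Me[OF b] by metis
    then show "(N a, N b) \<in> r i" using i by (force simp: le_iff)
  qed
  moreover have "M x = product_map n (\<lambda>j. if j = i then N else id) x" if x: "x \<in> P" for x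
    unfolding M_upd[OF x] using x i
    by (auto simp: product_map_def product_carrier_def PiE_def extensional_def restrict_def)
  ultimately show ?thesis using i by blast
qed

end

theorem theorem5p4:
  fixes n :: nat
    and K :: "nat \<Rightarrow> 'a set"
    and r :: "nat \<Rightarrow> 'a rel"
    and M :: "(nat \<Rightarrow> 'a) \<Rightarrow> (nat \<Rightarrow> 'a)"
  assumes graded: "\<And>i. i \<in> {1..n} \<Longrightarrow> finite_graded_poset (K i) (r i)"
    and M_maps: "M \<in> product_carrier n K \<rightarrow> product_carrier n K"
  shows "special_partial_matching (product_carrier n K) (product_order n K r) M \<longleftrightarrow>
    (\<exists>i\<in>{1..n}. \<exists>N. special_partial_matching (K i) (r i) N \<and>
      (\<forall>x\<in>product_carrier n K. M x = product_map n (\<lambda>j. if j = i then N else id) x))"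
proof -
  interpret graded_product n K r by (rule graded_product.intro) (rule graded)
  show ?thesis
  proof
    assume "special_partial_matching P R M"
    then interpret product_matching n K r M
      by (intro product_matching.intro graded_product_axioms)
    show "\<exists>i\<in>{1..n}. \<exists>N. special_partial_matching (K i) (r i) N \<and>
        (\<forall>x\<in>P. M x = product_map n (\<lambda>j. if j = i then N else id) x)"
      by (rule ex_coordinate_matching)
  qed (blast intro: special_partial_matching_product_map)
qed

end
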